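(* Let $A\in\mathbb{R}^{k_1\times k_2}$, $b_1\in\mathbb{R}^{k_1}$, $b_2\in\mathbb{R}^{k_2}$, and suppose the unconstrained bilinear zero-sum game defined by $(A,b_1,b_2)$ admits a Nash equilibrium $x^\star$, i.e. a point with $Gx^\star+c=0$. Fix $x^0\in\mathbb{R}^{k_1+k_2}$, and for $\eta>0$ let $x^1$ be obtained from $x^0$ by one step of Implicit Midpoint Gradient Descent (IMGD) with learning rate $\eta$, and let $\bar x^2=\frac{x^0+x^1}{2}$. Then $$\lVert G\bar x^2+c\rVert\in O(1/\eta)\qquad\text{as }\eta\to\infty,$$ where the implied constant may depend on $A,b_1,b_2,x^0$ but not on $\eta$.
   Context: The game: player 1 chooses $x_1\in\mathbb{R}^{k_1}$ and player 2 chooses $x_2\in\mathbb{R}^{k_2}$, with utilities $u_1(x_1,x_2)=x_1^\top A x_2+b_1^\top x_1-b_2^\top x_2$ and $u_2=-u_1$. Nash equilibria of this game are exactly the points $x^\star=(x_1^\star,x_2^\star)$ with $Gx^\star+c=0$, where $$G=\begin{pmatrix} 0 & A \\ -A^\top & 0 \end{pmatrix},\qquad c=\begin{pmatrix} b_1 \\ b_2 \end{pmatrix}.$$ Stack $x=(x_1,x_2)\in\mathbb{R}^{k_1+k_2}$. IMGD with learning rate $\eta>0$ is the iteration $$x^{t+1}=x^t+\tfrac{\eta}{2}\bigl((Gx^{t+1}+c)+(Gx^t+c)\bigr),$$ i.e. $x^{t+1}=(I-\tfrac{\eta}{2}G)^{-1}\bigl((I+\tfrac{\eta}{2}G)x^t+\eta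 c\bigr)$ (the inverse exists for every $\eta>0$). $\lVert\cdot\rVert$ is the Euclidean norm. *)

theory Defs
  imports "HOL-Analysis.Analysis" "HOL-Library.Landau_Symbols"
begin

definition stack :: "real ^ 'k1 \<Rightarrow> real ^ 'k2 \<Rightarrow> real ^ ('k1 + 'k2)" where
  "stack x1 x2 = (\<chi> i. case i of Inl a \<Rightarrow> x1 $ a | Inr b \<Rightarrow> x2 $ b)"

definition utility1 ::
  "real ^ 'k2 ^ 'k1 \<Rightarrow> real ^ 'k1 \<Rightarrow> real ^ 'k2 \<Rightarrow> real ^ 'k1 \<Rightarrow> real ^ 'k2 \<Rightarrow> real" where
  "utility1 A b1 b2 x1 x2 = x1 \<bullet> (A *v x2) + b1 \<bullet> x1 - b2 \<bullet> x2"

definition utility2 ::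
  "real ^ 'k2 ^ 'k1 \<Rightarrow> real ^ 'k1 \<Rightarrow> real ^ 'k2 \<Rightarrow> real ^ 'k1 \<Rightarrow> real ^ 'k2 \<Rightarrow> real" where
  "utility2 A b1 b2 x1 x2 = - utility1 A b1 b2 x1 x2"

definition nash_equilibrium ::
  "real ^ 'k2 ^ 'k1 \<Rightarrow> real ^ 'k1 \<Rightarrow> real ^ 'k2 \<Rightarrow> real ^ 'k1 \<Rightarrow> real ^ 'k2 \<Rightarrow> bool" where
  "nash_equilibrium A b1 b2 x1 x2 \<longleftrightarrow>
     (\<forall>y1. utility1 A b1 b2 y1 x2 \<le> utility1 A b1 b2 x1 x2) \<and>
     (\<forall>y2. utility2 A b1 b2 x1 y2 \<le> utility2 A b1 b2 x1 x2)"

definition game_matrix :: "real ^ 'k2 ^ 'k1 \<Rightarrow> real ^ ('k1 + 'k2) ^ ('k1 + 'k2)" where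
  "game_matrix A = (\<chi> i j. case (i, j) of
       (Inl a, Inl a') \<Rightarrow> 0
     | (Inl a, Inr b) \<Rightarrow> A $ a $ b
     | (Inr b, Inl a) \<Rightarrow> - (transpose A $ b $ a)
     | (Inr b, Inr b') \<Rightarrow> 0)"

(* The implicit midpoint update is an equation for the new iterate y; it always has
   exactly one solution, see imgd_step_iff below. *)
definition imgd_step ::
  "real ^ 'k2 ^ 'k1 \<Rightarrow> real ^ 'k1 \<Rightarrow> real ^ 'k2 \<Rightarrow> real \<Rightarrow>
   real ^ ('k1 + 'k2) \<Rightarrow> real ^ ('k1 + 'k2) \<Rightarrow> bool" where
  "imgd_step A b1 b2 \<eta> x y \<longleftrightarrow>
     y = x + (\<eta> / 2) *\<^sub>R ((game_matrix A *v y + stack b1 b2) + (game_matrix A *v x + stack b1 b2))"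

lemma sum_UNIV_Plus:
  fixes f :: "'a::finite + 'b::finite \<Rightarrow> 'c::comm_monoid_add"
  shows "sum f UNIV = (\<Sum>a\<in>UNIV. f (Inl a)) + (\<Sum>b\<in>UNIV. f (Inr b))"
  by (subst UNIV_Plus_UNIV[symmetric], subst sum.Plus) (simp_all add: o_def)

lemma game_matrix_stack:
  "game_matrix A *v stack x1 x2 = stack (A *v x2) (- (transpose A *v x1))"
  by (auto simp: vec_eq_iff game_matrix_def stack_def matrix_vector_mult_def
      sum_UNIV_Plus sum_negf split: sum.splits)

lemma linear_bounded_imp_zero:
  fixes v x :: "'a :: real_inner"
  assumes "\<And>y. v \<bullet> y \<le> v \<bullet> x"
  shows "v = 0"
proof -
  have "v \<bullet> v \<le> 0"
    using assms[of "x + v"] by (simp add: inner_add_right)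
  then show ?thesis
    by (metis inner_eq_zero_iff inner_ge_zero order_antisym)
qed

lemma nash_equilibrium_iff:
  "nash_equilibrium A b1 b2 x1 x2 \<longleftrightarrow> game_matrix A *v stack x1 x2 + stack b1 b2 = 0"
proof -
  have u1: "utility1 A b1 b2 y1 x2 = (A *v x2 + b1) \<bullet> y1 - b2 \<bullet> x2" for y1
    by (simp add: utility1_def inner_add_left) (simp add: inner_commute)
  have u2: "utility2 A b1 b2 x1 y2 = (- (transpose A *v x1) + b2) \<bullet> y2 - b1 \<bullet> x1" for y2
    by (simp add: utility2_def utility1_def inner_add_left dot_lmul_matrix[symmetric] inner_diff_left)
  have "nash_equilibrium A b1 b2 x1 x2 \<longleftrightarrow>
      A *v x2 + b1 = 0 \<and> - (transpose A *v x1) + b2 = 0"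
    unfolding nash_equilibrium_def u1 u2
    using linear_bounded_imp_zero[of "A *v x2 + b1" x1]
      linear_bounded_imp_zero[of "- (transpose A *v x1) + b2" x2]
    by auto
  also have "\<dots> \<longleftrightarrow> game_matrix A *v stack x1 x2 + stack b1 b2 = 0"
    unfolding game_matrix_stack
    by (force simp: vec_eq_iff stack_def split: sum.splits)
  finally show ?thesis .
qed

lemma game_matrix_skew: "x \<bullet> (game_matrix A *v x) = 0"
proof -
  have "transpose (game_matrix A) = - game_matrix A"
    by (auto simp: vec_eq_iff game_matrix_def transpose_def split: sum.splits)
  then have "x v* game_matrix A = - (game_matrix A *v x)"
    unfolding transpose_matrix_vector[symmetric]
    by (simp add: vec_eq_iff matrix_vector_mult_def sum_negf)
  then show ?thesis
    using dot_lmul_matrix[of x "game_matrix A" x] by (simp add: inner_commute)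
qed

lemma invertible_imgd: "invertible (mat 1 - (\<eta> / 2) *\<^sub>R game_matrix A)"
proof -
  have "x = 0" if "(mat 1 - (\<eta> / 2) *\<^sub>R game_matrix A) *v x = 0" for x
  proof -
    have "x = (\<eta> / 2) *\<^sub>R (game_matrix A *v x)"
      using that by (simp add: matrix_vector_mult_diff_rdistrib scaleR_matrix_vector_assoc)
    then have "x \<bullet> x = x \<bullet> ((\<eta> / 2) *\<^sub>R (game_matrix A *v x))" by simp
    also have "\<dots> = 0" by (simp add: game_matrix_skew)
    finally show ?thesis by simp
  qed
  then show ?thesis
    by (simp add: invertible_left_inverse matrix_left_invertible_ker)
qed

lemma imgd_step_iff:
  "imgd_step A b1 b2 \<eta> x y \<longleftrightarrow>
     y = matrix_inv (mat 1 - (\<eta> / 2) *\<^sub>R game_matrix A) *v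
         ((mat 1 + (\<eta> / 2) *\<^sub>R game_matrix A) *v x + \<eta> *\<^sub>R stack b1 b2)"
proof -
  let ?M = "mat 1 - (\<eta> / 2) *\<^sub>R game_matrix A"
  let ?r = "(mat 1 + (\<eta> / 2) *\<^sub>R game_matrix A) *v x + \<eta> *\<^sub>R stack b1 b2"
  have inv: "?M ** matrix_inv ?M = mat 1 \<and> matrix_inv ?M ** ?M = mat 1"
    using invertible_imgd[of \<eta> A] unfolding invertible_def matrix_inv_def by (rule someI_ex)
  have c: "(\<eta> / 2) *\<^sub>R c + (\<eta> / 2) *\<^sub>R c = \<eta> *\<^sub>R c" for c :: "'v :: real_vector"
    by (simp add: scaleR_add_left[symmetric])
  have "imgd_step A b1 b2 \<eta> x y \<longleftrightarrow> ?M *v y = ?r"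
    unfolding imgd_step_def matrix_vector_mult_diff_rdistrib matrix_vector_mult_add_rdistrib
      c[symmetric] scaleR_matrix_vector_assoc[symmetric] matrix_vector_mul_lid
      scaleR_add_right diff_eq_eq
    by (simp only: ac_simps)
  also have "\<dots> \<longleftrightarrow> y = matrix_inv ?M *v ?r"
  proof
    assume "?M *v y = ?r"
    then have "matrix_inv ?M *v ?r = (matrix_inv ?M ** ?M) *v y"
      by (simp only: matrix_vector_mul_assoc[symmetric])
    then show "y = matrix_inv ?M *v ?r"
      using inv by (simp only: matrix_vector_mul_lid)
  next
    assume "y = matrix_inv ?M *v ?r"
    then have "?M *v y = (?M ** matrix_inv ?M) *v ?r"
      by (simp only: matrix_vector_mul_assoc)
    then show "?M *v y = ?r"
      using inv by (simp only: matrix_vector_mul_lid)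
  qed
  finally show ?thesis .
qed

end

theory Submission
  imports Defs
begin

text \<open>With \<open>e\<close> the midpoint error and \<open>d\<close> the initial error, the step reads
  \<open>e - d = (\<eta>/2) *\<^sub>R G e\<close>. Since \<open>G\<close> is skew, \<open>e \<bottom> G e\<close>, so \<open>d\<close> is the hypotenuse
  of a right triangle with legs \<open>e\<close> and \<open>(\<eta>/2) *\<^sub>R G e\<close>; hence \<open>\<eta> * norm (G e) \<le> 2 * norm d\<close>.\<close>

lemma imgd_step_midpoint_residual_le:
  fixes A :: "real ^ 'k2 ^ 'k1" and xs x y :: "real ^ ('k1 + 'k2)"
  assumes equilibrium: "game_matrix A *v xs + stack b1 b2 = 0"
    and step: "imgd_step A b1 b2 \<eta> x y"
    and pos: "\<eta> > 0"
  shows "norm (game_matrix A *v ((1 / 2) *\<^sub>R (x + y)) + stack b1 b2) \<le> 2 * norm (x - xs) / \<eta>"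
proof -
  define e where "e = (1 / 2) *\<^sub>R (x + y) - xs"
  define g where "g = game_matrix A *v e"
  \<comment> \<open>Since \<open>xs\<close> is a zero of the affine gradient map, measuring from
    \<open>xs\<close> absorbs the constant \<open>stack b1 b2\<close> and leaves a linear
    residual.\<close>
  have residual: "game_matrix A *v ((1 / 2) *\<^sub>R (x + y)) + stack b1 b2 = g"
    using equilibrium unfolding g_def e_def
    by (simp add: matrix_vector_mult_diff_distrib eq_neg_iff_add_eq_0[symmetric])
  \<comment> \<open>An affine map commutes with averaging, so the two endpoint gradients add up to
    twice the midpoint one.\<close>
  have "(game_matrix A *v y + stack b1 b2) + (game_matrix A *v x + stack b1 b2) = 2 *\<^sub>R g"
    unfolding residual[symmetric]
    by (simp add: matrix_vector_right_distrib matrix_vector_mult_scaleR vec_eq_iff)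
  then have "y = x + \<eta> *\<^sub>R g"
    using step unfolding imgd_step_def by simp
  \<comment> \<open>The midpoint lies half a step, \<open>(\<eta> / 2) *\<^sub>R g\<close>, beyond
    \<open>x\<close>.\<close>
  then have initial_error: "x - xs = e - (\<eta> / 2) *\<^sub>R g"
    unfolding e_def by (simp add: scaleR_right_distrib flip: scaleR_left_distrib)
  have orthogonal: "e \<bullet> ((\<eta> / 2) *\<^sub>R g) = 0"
    by (simp add: g_def game_matrix_skew)
  have "(norm (x - xs))\<^sup>2 = (norm e)\<^sup>2 + (norm ((\<eta> / 2) *\<^sub>R g))\<^sup>2"
    unfolding initial_error power2_norm_eq_inner inner_diff_left inner_diff_right
      orthogonal orthogonal[unfolded inner_commute[of e]]
    by (simp only: diff_0_right diff_0 diff_minus_eq_add)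
  \<comment> \<open>A leg is at most the hypotenuse: drop \<open>(norm e)\<^sup>2\<close>.\<close>
  then have "norm ((\<eta> / 2) *\<^sub>R g) \<le> norm (x - xs)"
    by - (rule power2_le_imp_le, simp_all del: norm_scaleR)
  then show ?thesis
    unfolding residual using pos by (simp add: field_simps)
qed

theorem theorem4:
  fixes A :: "real ^ 'k2 ^ 'k1" and b1 :: "real ^ 'k1" and b2 :: "real ^ 'k2"
    and x1_star :: "real ^ 'k1" and x2_star :: "real ^ 'k2"
    and x0 :: "real ^ ('k1 + 'k2)" and x1 :: "real \<Rightarrow> real ^ ('k1 + 'k2)"
  assumes nash: "nash_equilibrium A b1 b2 x1_star x2_star"
    and step: "\<And>\<eta>. \<eta> > 0 \<Longrightarrow> imgd_step A b1 b2 \<eta> x0 (x1 \<eta>)"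
  shows "(\<lambda>\<eta>. norm (game_matrix A *v ((1 / 2) *\<^sub>R (x0 + x1 \<eta>)) + stack b1 b2))
           \<in> O[at_top](\<lambda>\<eta>. 1 / \<eta>)"
proof (rule bigoI)
  \<comment> \<open>The constant is twice the distance from \<open>x0\<close> to the given
    equilibrium, hence independent of \<open>\<eta>\<close>.\<close>
  show "\<forall>\<^sub>F \<eta> in at_top.
      norm (norm (game_matrix A *v ((1 / 2) *\<^sub>R (x0 + x1 \<eta>)) + stack b1 b2))
        \<le> 2 * norm (x0 - stack x1_star x2_star) * norm (1 / \<eta>)"
    using eventually_gt_at_top[of 0]
  proof eventually_elim
    case (elim \<eta>)
    then show ?case
      using imgd_step_midpoint_residual_le[OF nash[unfolded nash_equilibrium_iff] step[OF elim] elim]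
      by simp
  qed
qed

end
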